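(* (Energy-decaying property of the reference iteration.) Let $(u_1^0,u_2^0)\in\bar{\mathcal K}$ with $\mathcal E^{\tau_1,\tau_2}(u_1^0,u_2^0;\bar\Omega)<\infty$. The iterations, for $n=0,1,2,\dots$, $$(u_1^{2n+1},u_2^{2n+1})=\arg\min_{(u_1,u_2)\in\bar{\mathcal K}_{\mathrm{near}}(u_1^{2n},u_2^{2n})}\mathcal L^{\tau_1,\tau_2}\bigl(u_1-u_1^{2n},\,u_2-u_2^{2n},\,u_1^{2n},\,u_2^{2n};\bar\Omega\bigr),$$ $$(u_1^{2n+2},u_2^{2n+2})=\arg\min_{(u_1,u_2)\in\bar{\mathcal K}_{\mathrm{far}}(u_1^{2n+1},u_2^{2n+1})}\mathcal E^{\tau_1,\tau_2}(u_1,u_2;\bar\Omega)$$ satisfy the energy-decreasing property $$\mathcal E^{\tau_1,\tau_2}(u_1^{n+1},u_2^{n+1};\bar\Omega)\le\mathcal E^{\tau_1,\tau_2}(u_1^{n},u_2^{n};\bar\Omega)\qquad\text{for all } n\ge 0.$$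
   Context: Setting. Let $\psi:\mathbb R^2\to\mathbb R$ be $\mathbb Z^2$-periodic, $0<r\ll R$ and $c>1$. With $\mathbf x=(x,y,z)$, - solid: $S=\{\mathbf x\in\mathbb R^3: z\le\psi(x,y)\}$; - near-region: $C_{\mathrm{near}}=\{\mathbf x\in\mathbb R^3:\psi(x,y)<z<cr\}$; - far-region: $C_{\mathrm{far}}=\{\mathbf x\in\mathbb R^3: r<z<R\}$ (it overlaps $C_{\mathrm{near}}$); - $\bar\Omega=C_{\mathrm{near}}\cup C_{\mathrm{far}}\cup S$. Admissible sets: $$\bar{\mathcal K}=\{(u_1,u_2)\in BV(C_{\mathrm{near}}\cup C_{\mathrm{far}}): u_i(\mathbf x)\in[0,1],\ u_1(\mathbf x)+u_2(\mathbf x)=1\text{ for a.e. }\mathbf x\in C_{\mathrm{near}}\cup C_{\mathrm{far}}\}.$$ For $(v_1,v_2)\in\bar{\mathcal K}$, $$\bar{\mathcal K}_{\mathrm{near}}(v_1,v_2)=\{(u_1,u_2)\in\bar{\mathcal K}:(u_1,u_2)=(v_1,v_2)\text{ on }C_{\mathrm{far}}\setminus C_{\mathrm{near}}\},$$ $$\bar{\mathcal K}_{\mathrm{far}}(v_1,v_2)=\{(u_1,u_2)\in\bar{\mathcal K}:(u_1,u_2)=(v_1,v_2)\text{ on }C_{\mathrm{near}}\setminus C_{\mathrm{far}}\}.$$ Parameters: $\gamma_{LV},\gamma_{SL},\gamma_{SV}$ are the (constant) liquid–vapor, solid–liquid and solid–vapor energy densities, $\theta_Y$ is Young's angle, $\cos\theta_Y=(\gamma_{SV}-\gamma_{SL})/\gamma_{LV}$,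 $\tau_1>0$ and $\tau_2=\left(\frac{\pi\cos\theta_Y}{\pi-2\theta_Y}\right)^2\tau_1$. $G_\tau(\mathbf x)=(4\pi\tau)^{-3/2}\exp(-|\mathbf x|^2/(4\tau))$ is the heat kernel, $\ast$ denotes convolution, and $\mathbf 1_D$ is the indicator function of $D$. The functions $u_1,u_2$ play the role of the indicator functions of the liquid and vapor regions, so they vanish on $S$. Energy: $$\mathcal E^{\tau_1,\tau_2}(u_1,u_2;\bar\Omega)=\frac{\sqrt\pi\,\gamma_{LV}}{\sqrt{\tau_1}}\int_{\bar\Omega}u_1\,G_{\tau_1}\ast u_2\,d\mathbf x+\frac{\sqrt\pi\,\gamma_{SL}}{\sqrt{\tau_2}}\int_{\bar\Omega}u_1\,G_{\tau_2}\ast\mathbf 1_S\,d\mathbf x+\frac{\sqrt\pi\,\gamma_{SV}}{\sqrt{\tau_2}}\int_{\bar\Omega}u_2\,G_{\tau_2}\ast\mathbf 1_S\,d\mathbf x.$$ Linearized functional: $$\mathcal L^{\tau_1,\tau_2}(v_1,v_2,w_1,w_2;\bar\Omega)=\sqrt\pi\int_{\bar\Omega}v_1\Bigl(\tfrac{\gamma_{LV}}{\sqrt{\tau_1}}G_{\tau_1}\ast w_2+\tfrac{\gamma_{SL}}{\sqrt{\tau_2}}G_{\tau_2}\ast\mathbf 1_S\Bigr)d\mathbf x+\sqrt\pi\int_{\bar\Omega}v_2\Bigl(\tfrac{\gamma_{LV}}{\sqrt{\tau_1}}G_{\tau_1}\ast w_1+\tfrac{\gamma_{SV}}{\sqrt{\tau_2}}G_{\tau_2}\ast\mathbf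 1_S\Bigr)d\mathbf x.$$ *)

theory Defs
  imports "HOL-Analysis.Analysis"
begin

text \<open>
  Lateral convention. The regions below are invariant under integer translations in the first two
  coordinates, and have infinite volume. A natural number \<open>p\<close> selects the lateral setting:

  \<^item> \<open>p = 0\<close>: functions on the whole unbounded regions, integrals over the whole regions.
  \<^item> \<open>p \<ge> 1\<close>: functions that are \<open>p\<close>-periodic in the first two coordinates, integrals over one
    period, i.e. the lateral plane is replaced by the torus of side \<open>p\<close>. Convolutions are still
    taken over the whole space.

  For \<open>p = 0\<close> no pair of integrable functions can sum to 1 on a region of infinite volume, so the
  admissible set is empty; the settings with content are \<open>p \<ge> 1\<close>.
\<close>

definition column :: "nat \<Rightarrow> (real^3) set" where
  "column p = {x. p = 0 \<or> (0 \<le> x$1 \<and> x$1 < real p \<and> 0 \<le> x$2 \<and> x$2 < real p)}"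

definition lat_periodic :: "nat \<Rightarrow> (real^3 \<Rightarrow> 'a) \<Rightarrow> bool" where
  "lat_periodic p f \<longleftrightarrow>
     (\<forall>x. f (x + axis 1 (real p)) = f x \<and> f (x + axis 2 (real p)) = f x)"

definition Z2_periodic :: "(real \<times> real \<Rightarrow> real) \<Rightarrow> bool" where
  "Z2_periodic \<psi> \<longleftrightarrow> (\<forall>a b. \<psi> (a + 1, b) = \<psi> (a, b) \<and> \<psi> (a, b + 1) = \<psi> (a, b))"

definition solid :: "(real \<times> real \<Rightarrow> real) \<Rightarrow> (real^3) set" where
  "solid \<psi> = {x. x$3 \<le> \<psi> (x$1, x$2)}"

definition C_near :: "(real \<times> real \<Rightarrow> real) \<Rightarrow> real \<Rightarrow> real \<Rightarrow> (real^3) set" where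
  "C_near \<psi> c r = {x. \<psi> (x$1, x$2) < x$3 \<and> x$3 < c * r}"

definition C_far :: "real \<Rightarrow> real \<Rightarrow> (real^3) set" where
  "C_far r R = {x. r < x$3 \<and> x$3 < R}"

definition fluid :: "(real \<times> real \<Rightarrow> real) \<Rightarrow> real \<Rightarrow> real \<Rightarrow> real \<Rightarrow> (real^3) set" where
  "fluid \<psi> c r R = C_near \<psi> c r \<union> C_far r R"

definition Omega_bar :: "(real \<times> real \<Rightarrow> real) \<Rightarrow> real \<Rightarrow> real \<Rightarrow> real \<Rightarrow> (real^3) set" where
  "Omega_bar \<psi> c r R = C_near \<psi> c r \<union> C_far r R \<union> solid \<psi>"

definition divergence :: "(real^3 \<Rightarrow> real^3) \<Rightarrow> real^3 \<Rightarrow> real" where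
  "divergence \<phi> x = (\<Sum>i\<in>UNIV. frechet_derivative \<phi> (at x) (axis i 1) $ i)"

text \<open>
  Continuously differentiable vector fields, bounded by 1 and compactly supported in \<open>U\<close>; for
  \<open>p \<ge> 1\<close> the support is compact modulo the lateral translations.
\<close>

definition test_fields :: "nat \<Rightarrow> (real^3) set \<Rightarrow> (real^3 \<Rightarrow> real^3) set" where
  "test_fields p U = {\<phi>.
     (\<forall>x. \<phi> differentiable (at x)) \<and>
     (\<forall>i. continuous_on UNIV (\<lambda>x. frechet_derivative \<phi> (at x) (axis i 1))) \<and>
     (\<forall>x. norm (\<phi> x) \<le> 1) \<and>
     lat_periodic p \<phi> \<and>
     closure {x. \<phi> x \<noteq> 0} \<subseteq> U \<and>
     compact (closure {x. \<phi> x \<noteq> 0} \<inter> closure (column p))}"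

definition BV :: "nat \<Rightarrow> (real^3) set \<Rightarrow> (real^3 \<Rightarrow> real) set" where
  "BV p U = {u.
     u \<in> borel_measurable borel \<and> lat_periodic p u \<and>
     set_integrable lborel (U \<inter> column p) u \<and>
     (\<exists>M. \<forall>\<phi>\<in>test_fields p U. (LINT x:U \<inter> column p|lborel. u x * divergence \<phi> x) \<le> M)}"

text \<open>
  A pair on the fluid region is represented by its extension by zero to the whole space. It then
  vanishes on the solid whenever \<open>\<psi> \<le> r\<close>, i.e. when the solid does not reach into the far region.
\<close>

definition admissible ::
  "nat \<Rightarrow> (real \<times> real \<Rightarrow> real) \<Rightarrow> real \<Rightarrow> real \<Rightarrow> real
    \<Rightarrow> ((real^3 \<Rightarrow> real) \<times> (real^3 \<Rightarrow> real)) set" where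
  "admissible p \<psi> c r R = {(u1, u2).
     u1 \<in> BV p (fluid \<psi> c r R) \<and> u2 \<in> BV p (fluid \<psi> c r R) \<and>
     (AE x in lborel. x \<in> fluid \<psi> c r R \<longrightarrow>
        u1 x \<in> {0..1} \<and> u2 x \<in> {0..1} \<and> u1 x + u2 x = 1) \<and>
     (\<forall>x. x \<notin> fluid \<psi> c r R \<longrightarrow> u1 x = 0 \<and> u2 x = 0)}"

definition admissible_near ::
  "nat \<Rightarrow> (real \<times> real \<Rightarrow> real) \<Rightarrow> real \<Rightarrow> real \<Rightarrow> real
    \<Rightarrow> (real^3 \<Rightarrow> real) \<Rightarrow> (real^3 \<Rightarrow> real)
    \<Rightarrow> ((real^3 \<Rightarrow> real) \<times> (real^3 \<Rightarrow> real)) set" where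
  "admissible_near p \<psi> c r R v1 v2 = {(u1, u2) \<in> admissible p \<psi> c r R.
     AE x in lborel. x \<in> C_far r R - C_near \<psi> c r \<longrightarrow> u1 x = v1 x \<and> u2 x = v2 x}"

definition admissible_far ::
  "nat \<Rightarrow> (real \<times> real \<Rightarrow> real) \<Rightarrow> real \<Rightarrow> real \<Rightarrow> real
    \<Rightarrow> (real^3 \<Rightarrow> real) \<Rightarrow> (real^3 \<Rightarrow> real)
    \<Rightarrow> ((real^3 \<Rightarrow> real) \<times> (real^3 \<Rightarrow> real)) set" where
  "admissible_far p \<psi> c r R v1 v2 = {(u1, u2) \<in> admissible p \<psi> c r R.
     AE x in lborel. x \<in> C_near \<psi> c r - C_far r R \<longrightarrow> u1 x = v1 x \<and> u2 x = v2 x}"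

definition heat_kernel :: "real \<Rightarrow> real^3 \<Rightarrow> real" where
  "heat_kernel \<tau> x = (4 * pi * \<tau>) powr (- 3 / 2) * exp (- (norm x)\<^sup>2 / (4 * \<tau>))"

definition heat_conv :: "real \<Rightarrow> (real^3 \<Rightarrow> real) \<Rightarrow> real^3 \<Rightarrow> real" where
  "heat_conv \<tau> f x = (LINT y|lborel. heat_kernel \<tau> (x - y) * f y)"

text \<open>
  At \<open>\<theta> = pi / 2\<close> the quotient has the form 0/0; the value used there is the limit of the
  formula as \<open>\<theta>\<close> tends to \<open>pi / 2\<close>.
\<close>

definition tau2_of :: "real \<Rightarrow> real \<Rightarrow> real" where
  "tau2_of \<theta> \<tau>1 =
     (if \<theta> = pi / 2 then (pi / 2)\<^sup>2 * \<tau>1 else (pi * cos \<theta> / (pi - 2 * \<theta>))\<^sup>2 * \<tau>1)"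

text \<open>
  On admissible pairs all integrands of the energy are nonnegative almost everywhere, so the
  energy is a well-defined element of \<open>[0, \<infinity>]\<close>.
\<close>

definition energy ::
  "nat \<Rightarrow> (real \<times> real \<Rightarrow> real) \<Rightarrow> real \<Rightarrow> real \<Rightarrow> real
    \<Rightarrow> real \<Rightarrow> real \<Rightarrow> real \<Rightarrow> real \<Rightarrow> real
    \<Rightarrow> (real^3 \<Rightarrow> real) \<Rightarrow> (real^3 \<Rightarrow> real) \<Rightarrow> ennreal" where
  "energy p \<psi> c r R \<gamma>LV \<gamma>SL \<gamma>SV \<tau>1 \<tau>2 u1 u2 =
     ennreal (sqrt pi * \<gamma>LV / sqrt \<tau>1) *
       (\<integral>\<^sup>+x\<in>Omega_bar \<psi> c r R \<inter> column p. ennreal (u1 x * heat_conv \<tau>1 u2 x) \<partial>lborel) +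
     ennreal (sqrt pi * \<gamma>SL / sqrt \<tau>2) *
       (\<integral>\<^sup>+x\<in>Omega_bar \<psi> c r R \<inter> column p.
          ennreal (u1 x * heat_conv \<tau>2 (indicator (solid \<psi>)) x) \<partial>lborel) +
     ennreal (sqrt pi * \<gamma>SV / sqrt \<tau>2) *
       (\<integral>\<^sup>+x\<in>Omega_bar \<psi> c r R \<inter> column p.
          ennreal (u2 x * heat_conv \<tau>2 (indicator (solid \<psi>)) x) \<partial>lborel)"

definition lin_functional ::
  "nat \<Rightarrow> (real \<times> real \<Rightarrow> real) \<Rightarrow> real \<Rightarrow> real \<Rightarrow> real
    \<Rightarrow> real \<Rightarrow> real \<Rightarrow> real \<Rightarrow> real \<Rightarrow> real
    \<Rightarrow> (real^3 \<Rightarrow> real) \<Rightarrow> (real^3 \<Rightarrow> real) \<Rightarrow> (real^3 \<Rightarrow> real) \<Rightarrow> (real^3 \<Rightarrow> real) \<Rightarrow> real" where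
  "lin_functional p \<psi> c r R \<gamma>LV \<gamma>SL \<gamma>SV \<tau>1 \<tau>2 v1 v2 w1 w2 =
     sqrt pi * (LINT x:Omega_bar \<psi> c r R \<inter> column p|lborel.
       v1 x * (\<gamma>LV / sqrt \<tau>1 * heat_conv \<tau>1 w2 x
             + \<gamma>SL / sqrt \<tau>2 * heat_conv \<tau>2 (indicator (solid \<psi>)) x)) +
     sqrt pi * (LINT x:Omega_bar \<psi> c r R \<inter> column p|lborel.
       v2 x * (\<gamma>LV / sqrt \<tau>1 * heat_conv \<tau>1 w1 x
             + \<gamma>SV / sqrt \<tau>2 * heat_conv \<tau>2 (indicator (solid \<psi>)) x))"

end

theory Submission
  imports Defs "HOL-Probability.Distributions"
begin

text \<open>
  The energy is a bilinear form plus linear terms, so that a step from \<open>u\<close> to \<open>w = u + v\<close>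
  changes it by the linearized functional of \<open>v\<close> plus a multiple of
  \<open>\<integral> v\<^sub>1 G\<^sub>\<tau> * v\<^sub>2\<close>. Since \<open>v\<^sub>2 = - v\<^sub>1\<close>, the quadratic term equals
  \<open>- \<integral> v\<^sub>1 G\<^sub>\<tau> * v\<^sub>1 = - \<integral> (G\<^bsub>\<tau>/2\<^esub> * v\<^sub>1)\<^sup>2 \<le> 0\<close> by the semigroup property of the heat
  kernel and the symmetry of the form, and the linear one is at most its value \<open>0\<close> at \<open>v = 0\<close>.
  Symmetry over one lateral period holds because the integral of a periodic function over a
  fundamental domain does not depend on the domain. A far step is an exact minimization.
\<close>

section \<open>Translation and reflection invariance of Lebesgue measure\<close>

lemma lborel_distr_minus_const:
  fixes c :: "'a::euclidean_space"
  shows "distr lborel borel (\<lambda>y. c - y) = lborel"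
  by (subst lborel_affine[of "-1" c]) (auto simp: density_1 one_ennreal_def[symmetric])

lemma nn_integral_lborel_shift:
  fixes f :: "'a::euclidean_space \<Rightarrow> ennreal"
  assumes [measurable]: "f \<in> borel_measurable borel"
  shows "(\<integral>\<^sup>+x. f (x + c) \<partial>lborel) = (\<integral>\<^sup>+x. f x \<partial>lborel)"
proof -
  have "(\<integral>\<^sup>+x. f x \<partial>lborel) = (\<integral>\<^sup>+x. f x \<partial>distr lborel borel ((+) c))"
    by (simp only: lborel_distr_plus)
  also have "\<dots> = (\<integral>\<^sup>+x. f (x + c) \<partial>lborel)"
    by (subst nn_integral_distr) (simp_all add: add.commute)
  finally show ?thesis by simp
qed

lemma integral_lborel_reflect:
  fixes f :: "'a::euclidean_space \<Rightarrow> real"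
  assumes [measurable]: "f \<in> borel_measurable borel"
  shows "(LINT y|lborel. f (c - y)) = (LINT y|lborel. f y)"
    and "integrable lborel (\<lambda>y. f (c - y)) \<longleftrightarrow> integrable lborel f"
proof -
  have "(LINT y|lborel. f y) = (LINT y|distr lborel borel (\<lambda>y. c - y). f y)"
    by (simp only: lborel_distr_minus_const)
  also have "\<dots> = (LINT y|lborel. f (c - y))"
    by (subst integral_distr) simp_all
  finally show "(LINT y|lborel. f (c - y)) = (LINT y|lborel. f y)" by simp
  have "integrable lborel f \<longleftrightarrow> integrable (distr lborel borel (\<lambda>y. c - y)) f"
    by (simp only: lborel_distr_minus_const)
  also have "\<dots> \<longleftrightarrow> integrable lborel (\<lambda>y. f (c - y))"
    by (subst integrable_distr_eq) simp_all
  finally show "integrable lborel (\<lambda>y. f (c - y)) \<longleftrightarrow> integrable lborel f" by simp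
qed

section \<open>The heat kernel: total mass and semigroup property\<close>

lemma heat_kernel_nonneg: "0 \<le> heat_kernel \<tau> x"
  by (simp add: heat_kernel_def)

lemma heat_kernel_minus: "heat_kernel \<tau> (- x) = heat_kernel \<tau> x"
  by (simp add: heat_kernel_def)

lemma heat_kernel_measurable [measurable]: "heat_kernel \<tau> \<in> borel_measurable borel"
  unfolding heat_kernel_def[abs_def] by measurable

text \<open>A Gaussian factors over the coordinates; each factor has variance
  \<open>2 * \<tau>\<close>, so the total mass reduces to that of the one-dimensional normal
  density.\<close>

lemma heat_kernel_eq_prod:
  assumes "0 < \<tau>"
  shows "heat_kernel \<tau> x = (\<Prod>b\<in>Basis. normal_density 0 (sqrt (2 * \<tau>)) (x \<bullet> b))"
proof -
  have card: "card (Basis :: (real^3) set) = 3"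
    using DIM_cart[where 'a=real and 'b=3] by simp
  have "(\<Prod>b\<in>Basis. normal_density 0 (sqrt (2 * \<tau>)) (x \<bullet> b)) =
      (1 / sqrt (4 * pi * \<tau>)) ^ 3 * exp (\<Sum>b\<in>Basis. - (x \<bullet> b)\<^sup>2 / (4 * \<tau>))"
    using assms by (simp add: normal_density_def prod.distrib exp_sum prod_dividef card
        power_divide mult_ac)
  also have "(\<Sum>b\<in>Basis. - (x \<bullet> b)\<^sup>2 / (4 * \<tau>)) = - (norm x)\<^sup>2 / (4 * \<tau>)"
    unfolding power2_norm_eq_inner[of x] euclidean_inner[of x x]
    by (simp add: sum_divide_distrib sum_negf power2_eq_square)
  also have "(1 / sqrt (4 * pi * \<tau>)) ^ 3 = (4 * pi * \<tau>) powr (- 3 / 2)"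
  proof -
    have "(1 / sqrt (4 * pi * \<tau>)) ^ 3 = ((4 * pi * \<tau>) powr (- (1 / 2))) ^ 3"
      unfolding powr_minus_divide using assms by (subst powr_half_sqrt) auto
    also have "\<dots> = (4 * pi * \<tau>) powr (real 3 * (- (1 / 2)))"
      by (rule powr_power) (use assms in simp)
    also have "real 3 * (- (1 / 2)) = - 3 / 2"
      by simp
    finally show ?thesis .
  qed
  finally show ?thesis by (simp add: heat_kernel_def)
qed

lemma nn_integral_heat_kernel:
  assumes "0 < \<tau>"
  shows "(\<integral>\<^sup>+x. ennreal (heat_kernel \<tau> x) \<partial>lborel) = 1"
proof -
  let ?f = "normal_density 0 (sqrt (2 * \<tau>))"
  have 1: "(\<integral>\<^sup>+x. ennreal (?f x) \<partial>lborel) = 1"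
    using assms by (subst nn_integral_eq_integral)
      (auto intro!: integrable_normal_density simp: integral_normal_density)
  have "(\<integral>\<^sup>+x. ennreal (heat_kernel \<tau> x) \<partial>lborel) =
      (\<integral>\<^sup>+x. (\<Prod>b\<in>Basis. ennreal (?f (x \<bullet> b))) \<partial>(lborel :: (real^3) measure))"
    by (simp add: heat_kernel_eq_prod[OF assms] prod_ennreal)
  also have "\<dots> = (\<Prod>b\<in>(Basis :: (real^3) set). (\<integral>\<^sup>+x. ennreal (?f x) \<partial>lborel))"
    by (rule nn_integral_lborel_prod) auto
  finally show ?thesis by (simp add: 1)
qed

lemma heat_kernel_integrable:
  assumes "0 < \<tau>"
  shows "integrable lborel (heat_kernel \<tau>)"
  by (rule integrableI_nonneg) (auto simp: heat_kernel_nonneg nn_integral_heat_kernel[OF assms])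

lemma integral_heat_kernel:
  assumes "0 < \<tau>"
  shows "(LINT x|lborel. heat_kernel \<tau> x) = 1"
  by (subst integral_eq_nn_integral) (auto simp: heat_kernel_nonneg nn_integral_heat_kernel[OF assms])

lemma heat_kernel_integrable_shift:
  assumes "0 < \<tau>"
  shows "integrable lborel (\<lambda>y. heat_kernel \<tau> (x - y))"
  using heat_kernel_integrable[OF assms] by (subst integral_lborel_reflect) auto

lemma integral_heat_kernel_shift:
  assumes "0 < \<tau>"
  shows "(LINT y|lborel. heat_kernel \<tau> (x - y)) = 1"
  using integral_heat_kernel[OF assms] by (subst integral_lborel_reflect) auto

text \<open>Completing the square in \<open>z\<close> about the midpoint of \<open>x\<close> and
  \<open>y\<close>: all dependence on \<open>z\<close> is collected in one Gaussian of time
  \<open>\<tau>/4\<close>.\<close>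

lemma heat_kernel_mult:
  assumes "0 < \<tau>"
  shows "heat_kernel (\<tau>/2) (x - z) * heat_kernel (\<tau>/2) (z - y) =
    heat_kernel \<tau> (x - y) * heat_kernel (\<tau>/4) ((1/2) *\<^sub>R (x + y) - z)"
proof -
  \<comment> \<open>The parallelogram law for \<open>x - z\<close> and \<open>z - y\<close>, whose
    sum is \<open>x - y\<close> and whose difference is twice the midpoint minus
    \<open>2 z\<close>.\<close>
  have sq: "(norm (x - z))\<^sup>2 / 2 + (norm (z - y))\<^sup>2 / 2 =
      (norm (x - y))\<^sup>2 / 4 + (norm ((1/2) *\<^sub>R (x + y) - z))\<^sup>2"
    unfolding power2_norm_eq_inner by (simp add: inner_simps inner_commute field_simps)
  have "- (norm (x - z))\<^sup>2 / (4 * (\<tau>/2)) + - (norm (z - y))\<^sup>2 / (4 * (\<tau>/2)) =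
      - ((norm (x - z))\<^sup>2 / 2 + (norm (z - y))\<^sup>2 / 2) / \<tau>"
    using assms by (simp add: field_simps)
  also have "\<dots> = - (norm (x - y))\<^sup>2 / (4 * \<tau>) + - (norm ((1/2) *\<^sub>R (x + y) - z))\<^sup>2 / (4 * (\<tau>/4))"
    unfolding sq using assms by (simp add: field_simps)
  finally have e: "- (norm (x - z))\<^sup>2 / (4 * (\<tau>/2)) + - (norm (z - y))\<^sup>2 / (4 * (\<tau>/2)) = \<dots>" .
  \<comment> \<open>The normalizing constants match because
    \<open>(\<tau>/2) * (\<tau>/2) = \<tau> * (\<tau>/4)\<close>.\<close>
  have c: "(4 * pi * (\<tau>/2)) powr (- 3 / 2) * (4 * pi * (\<tau>/2)) powr (- 3 / 2) =
      (4 * pi * \<tau>) powr (- 3 / 2) * (4 * pi * (\<tau>/4)) powr (- 3 / 2)"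
  proof -
    have "4 * pi * (\<tau>/2) * (4 * pi * (\<tau>/2)) = 4 * pi * \<tau> * (4 * pi * (\<tau>/4))"
      by simp
    then show ?thesis
      using assms powr_mult[of "4 * pi * (\<tau>/2)" "4 * pi * (\<tau>/2)" "- 3 / 2"]
        powr_mult[of "4 * pi * \<tau>" "4 * pi * (\<tau>/4)" "- 3 / 2"] by (simp only:)
  qed
  show ?thesis
    unfolding heat_kernel_def
    using arg_cong2[OF c arg_cong[OF e, of exp], of "(*)"]
    by (simp only: exp_add mult_ac)
qed

text \<open>After the factorization only the Gaussian of time \<open>\<tau>/4\<close> depends on
  \<open>z\<close>, and it has mass one.\<close>

lemma heat_kernel_semigroup:
  assumes "0 < \<tau>"
  shows "(LINT z|lborel. heat_kernel (\<tau>/2) (x - z) * heat_kernel (\<tau>/2) (z - y)) = heat_kernel \<tau> (x - y)"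
  unfolding heat_kernel_mult[OF assms] using integral_heat_kernel_shift[of "\<tau>/4"] assms by simp

section \<open>Lattice translations and integration over a fundamental domain\<close>

definition lat_vec :: "nat \<Rightarrow> int \<times> int \<Rightarrow> real^3" where
  "lat_vec p k = axis 1 (real p * real_of_int (fst k)) + axis 2 (real p * real_of_int (snd k))"

lemma periodic_add_of_int_mult:
  fixes f :: "'a::real_vector \<Rightarrow> 'b"
  assumes "\<And>x. f (x + a) = f x"
  shows "f (x + real_of_int k *\<^sub>R a) = f x"
proof (cases k)
  have nat: "f (y + real n *\<^sub>R a) = f y" for y n
  proof (induction n)
    case (Suc n)
    have "f (y + real (Suc n) *\<^sub>R a) = f ((y + real n *\<^sub>R a) + a)"
      by (simp add: algebra_simps)
    then show ?case using assms Suc by simp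
  qed simp
  {
    case (nonneg n)
    then show ?thesis using nat by simp
  next
    case (neg n)
    show ?thesis
      \<comment> \<open>The natural-number case is used at the translated point, from which
        \<open>Suc n\<close> forward steps lead back to \<open>x\<close>.\<close>
      using nat[of "x + real_of_int (- int (Suc n)) *\<^sub>R a" "Suc n"] unfolding neg
      by (simp add: algebra_simps)
  }
qed

lemma lat_periodic_lat_vec:
  assumes "lat_periodic p f"
  shows "f (x + lat_vec p k) = f x"
proof -
  have v: "lat_vec p k = real_of_int (fst k) *\<^sub>R axis 1 (real p) + real_of_int (snd k) *\<^sub>R axis 2 (real p)"
    by (auto simp: lat_vec_def vec_eq_iff axis_def)
  show ?thesis
    using assms periodic_add_of_int_mult[of f "axis 1 (real p)"]
      periodic_add_of_int_mult[of f "axis 2 (real p)"]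
    unfolding v lat_periodic_def by (simp flip: add.assoc)
qed

lemma column_measurable [measurable]: "column p \<in> sets borel"
proof -
  have "column p = (if p = 0 then UNIV else
     {x \<in> space borel. 0 \<le> x$1 \<and> x$1 < real p \<and> 0 \<le> x$2 \<and> x$2 < real p})"
    by (auto simp: column_def)
  moreover have "{x \<in> space borel. 0 \<le> x$1 \<and> x$1 < real p \<and> 0 \<le> (x::real^3)$2 \<and> x$2 < real p} \<in> sets borel"
    by measurable
  ultimately show ?thesis by simp
qed

text \<open>Division with remainder in the two lateral coordinates: since the column is half-open,
  the floors give the one lattice vector that works.\<close>

lemma column_minus_lat_vec_iff:
  assumes "0 < p"
  shows "y - lat_vec p k \<in> column p \<longleftrightarrow> k = (\<lfloor>y$1 / real p\<rfloor>, \<lfloor>y$2 / real p\<rfloor>)"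
proof -
  have c: "(0 \<le> t - real p * real_of_int m \<and> t - real p * real_of_int m < real p) \<longleftrightarrow> m = \<lfloor>t / real p\<rfloor>" for t m
  proof -
    have "m = \<lfloor>t / real p\<rfloor> \<longleftrightarrow> real_of_int m \<le> t / real p \<and> t / real p < real_of_int m + 1"
      by (metis floor_eq_iff)
    also have "\<dots> \<longleftrightarrow> (0 \<le> t - real p * real_of_int m \<and> t - real p * real_of_int m < real p)"
      using assms by (simp add: pos_le_divide_eq pos_divide_less_eq algebra_simps)
    finally show ?thesis by simp
  qed
  have "y - lat_vec p k \<in> column p \<longleftrightarrow>
     (0 \<le> y$1 - real p * real_of_int (fst k) \<and> y$1 - real p * real_of_int (fst k) < real p) \<and>
     (0 \<le> y$2 - real p * real_of_int (snd k) \<and> y$2 - real p * real_of_int (snd k) < real p)"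
    using assms by (auto simp: column_def lat_vec_def axis_def)
  then show ?thesis unfolding c by (cases k) auto
qed

text \<open>The tiling of space by translates of the column, stated as a partition of unity so that
  it can be inserted as a factor 1 under an integral. The version with plus follows by negating the
  lattice index.\<close>

lemma nn_integral_lattice_column:
  assumes "0 < p"
  shows "(\<integral>\<^sup>+k. indicator (column p) (y - lat_vec p k) \<partial>count_space UNIV) = 1"
    and "(\<integral>\<^sup>+k. indicator (column p) (y + lat_vec p k) \<partial>count_space UNIV) = 1"
proof -
  have 1: "(indicator (column p) (y - lat_vec p k) :: ennreal) =
      indicator {(\<lfloor>y$1 / real p\<rfloor>, \<lfloor>y$2 / real p\<rfloor>)} k" for k
    using column_minus_lat_vec_iff[OF assms, of y k] by (simp add: indicator_def)
  show "(\<integral>\<^sup>+k. indicator (column p) (y - lat_vec p k) \<partial>count_space UNIV) = 1"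
    unfolding 1 by simp
  have m: "y + lat_vec p k = y - lat_vec p (- fst k, - snd k)" for k
    by (simp add: lat_vec_def vec_eq_iff axis_def)
  have 2: "(indicator (column p) (y + lat_vec p k) :: ennreal) =
      indicator {(- \<lfloor>y$1 / real p\<rfloor>, - \<lfloor>y$2 / real p\<rfloor>)} k" for k
    unfolding m using column_minus_lat_vec_iff[OF assms, of y "(- fst k, - snd k)"]
    by (cases k) (auto simp: indicator_def)
  show "(\<integral>\<^sup>+k. indicator (column p) (y + lat_vec p k) \<partial>count_space UNIV) = 1"
    unfolding 2 by simp
qed

text \<open>
  The column and its translate by \<open>z\<close> are two fundamental domains of the lattice; the
  integral over one is cut along the lattice translates of the other and reassembled.
\<close>
lemma nn_integral_column_shift:
  fixes h :: "real^3 \<Rightarrow> ennreal"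
  assumes h [measurable]: "h \<in> borel_measurable borel" and per: "lat_periodic p h"
  shows "(\<integral>\<^sup>+x. h (x + z) * indicator (column p) x \<partial>lborel) = (\<integral>\<^sup>+x. h x * indicator (column p) x \<partial>lborel)"
\<comment> \<open>For \<open>p = 0\<close> all lattice vectors vanish and the column is the whole
  space, so plain translation invariance applies instead of a tiling.\<close>
proof (cases "p = 0")
  case True
  then show ?thesis using nn_integral_lborel_shift[OF h] by (simp add: column_def)
next
  case False
  then have p: "0 < p" by simp
  let ?C = "indicator (column p) :: real^3 \<Rightarrow> ennreal"
  have "(\<integral>\<^sup>+x. h (x + z) * ?C x \<partial>lborel) = (\<integral>\<^sup>+x. h x * ?C (x - z) \<partial>lborel)"
    using nn_integral_lborel_shift[of "\<lambda>x. h x * ?C (x - z)" z] by simp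
  also have "\<dots> = (\<integral>\<^sup>+x. (\<integral>\<^sup>+k. h x * ?C (x - z) * ?C (x - lat_vec p k) \<partial>count_space UNIV) \<partial>lborel)"
    by (simp add: nn_integral_cmult nn_integral_lattice_column[OF p])
  also have "\<dots> = (\<integral>\<^sup>+k. (\<integral>\<^sup>+x. h x * ?C (x - z) * ?C (x - lat_vec p k) \<partial>lborel) \<partial>count_space UNIV)"
    by (rule nn_integral_count_space_nn_integral) auto
  also have "\<dots> = (\<integral>\<^sup>+k. (\<integral>\<^sup>+x. h x * ?C x * ?C ((x - z) + lat_vec p k) \<partial>lborel) \<partial>count_space UNIV)"
  proof (rule nn_integral_cong)
    fix k
    \<comment> \<open>In the summand of index \<open>k\<close> the variable is translated by
      \<open>lat_vec p k\<close>. Periodicity of \<open>h\<close> absorbs the translation, and the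
      lattice vector passes from one column to the other.\<close>
    have "(\<integral>\<^sup>+x. h x * ?C (x - z) * ?C (x - lat_vec p k) \<partial>lborel) =
        (\<integral>\<^sup>+x. h (x + lat_vec p k) * ?C (x + lat_vec p k - z) * ?C (x + lat_vec p k - lat_vec p k) \<partial>lborel)"
      by (rule nn_integral_lborel_shift[symmetric]) measurable
    then show "(\<integral>\<^sup>+x. h x * ?C (x - z) * ?C (x - lat_vec p k) \<partial>lborel) =
        (\<integral>\<^sup>+x. h x * ?C x * ?C ((x - z) + lat_vec p k) \<partial>lborel)"
      by (simp add: lat_periodic_lat_vec[OF per] algebra_simps)
  qed
  also have "\<dots> = (\<integral>\<^sup>+x. (\<integral>\<^sup>+k. h x * ?C x * ?C ((x - z) + lat_vec p k) \<partial>count_space UNIV) \<partial>lborel)"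
    by (rule nn_integral_count_space_nn_integral[symmetric]) auto
  also have "\<dots> = (\<integral>\<^sup>+x. h x * ?C x \<partial>lborel)"
    by (simp add: nn_integral_cmult nn_integral_lattice_column[OF p])
  finally show ?thesis .
qed

lemma lat_periodic_compose: "lat_periodic p f \<Longrightarrow> lat_periodic p (\<lambda>x. g (f x))"
  by (simp add: lat_periodic_def)

lemma lat_periodic_shift: "lat_periodic p f \<Longrightarrow> lat_periodic p (\<lambda>x. f (x + z))"
proof -
  have "x + axis i (real p) + z = (x + z) + axis i (real p)" for x :: "real^3" and i
    by simp
  then show "lat_periodic p f \<Longrightarrow> lat_periodic p (\<lambda>x. f (x + z))"
    unfolding lat_periodic_def by metis
qed

text \<open>The signed case is assembled from three nonnegative ones: the absolute value gives
  integrability, the positive and negative parts give the value.\<close>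

lemma set_integrable_column_shift:
  fixes h :: "real^3 \<Rightarrow> real"
  assumes h [measurable]: "h \<in> borel_measurable borel" and per: "lat_periodic p h"
    and int: "set_integrable lborel (column p) h"
  shows "set_integrable lborel (column p) (\<lambda>x. h (x + z))"
    and "(LINT x:column p|lborel. h (x + z)) = (LINT x:column p|lborel. h x)"
proof -
  let ?C = "indicator (column p) :: real^3 \<Rightarrow> ennreal"
  \<comment> \<open>Used with \<open>g\<close> the absolute value, the identity and negation;
    \<open>ennreal\<close> truncates the last two to the positive and negative parts.\<close>
  have eq: "(\<integral>\<^sup>+x. ennreal (g (h (x + z))) * ?C x \<partial>lborel) = (\<integral>\<^sup>+x. ennreal (g (h x)) * ?C x \<partial>lborel)"
    if [measurable]: "g \<in> borel_measurable borel" for g :: "real \<Rightarrow> real"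
    by (rule nn_integral_column_shift[where h = "\<lambda>x. ennreal (g (h x))"])
      (auto intro: lat_periodic_compose[OF per, of "\<lambda>t. ennreal (g t)"])
  have i: "ennreal (g (indicator (column p) x *\<^sub>R y)) = ennreal (g y) * ?C x"
    if "g 0 = 0" for g :: "real \<Rightarrow> real" and x y
    using that by (auto split: split_indicator)
  show 1: "set_integrable lborel (column p) (\<lambda>x. h (x + z))"
    using int eq[of abs]
    unfolding set_integrable_def integrable_iff_bounded real_norm_def i[of abs, OF abs_zero] by simp
  show "(LINT x:column p|lborel. h (x + z)) = (LINT x:column p|lborel. h x)"
    using eq[of "\<lambda>t. t"] eq[of uminus]
    unfolding set_lebesgue_integral_def
      real_lebesgue_integral_def[OF int[unfolded set_integrable_def]]
      real_lebesgue_integral_def[OF 1[unfolded set_integrable_def]]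
      i[of "\<lambda>t. t", OF refl] i[of uminus, OF minus_zero] by simp
qed

section \<open>Convolution with the heat kernel\<close>

lemma heat_conv_measurable [measurable]:
  assumes [measurable]: "g \<in> borel_measurable borel"
  shows "heat_conv \<tau> g \<in> borel_measurable borel"
  unfolding heat_conv_def[abs_def] by measurable

lemma heat_conv_integrable:
  assumes \<tau>: "0 < \<tau>" and [measurable]: "g \<in> borel_measurable borel"
    and M: "AE y in lborel. \<bar>g y\<bar> \<le> M"
  shows "integrable lborel (\<lambda>y. heat_kernel \<tau> (x - y) * g y)"
proof (rule Bochner_Integration.integrable_bound)
  show "integrable lborel (\<lambda>y. M * heat_kernel \<tau> (x - y))"
    using heat_kernel_integrable_shift[OF \<tau>] by simp
  show "AE y in lborel. norm (heat_kernel \<tau> (x - y) * g y) \<le> norm (M * heat_kernel \<tau> (x - y))"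
    using M
  proof eventually_elim
    case (elim y)
    then have "\<bar>g y\<bar> * heat_kernel \<tau> (x - y) \<le> \<bar>M\<bar> * heat_kernel \<tau> (x - y)"
      by (intro mult_right_mono heat_kernel_nonneg) simp
    then show ?case by (simp add: abs_mult heat_kernel_nonneg mult.commute)
  qed
qed measurable

lemma heat_conv_bound:
  assumes \<tau>: "0 < \<tau>" and g [measurable]: "g \<in> borel_measurable borel"
    and M: "AE y in lborel. \<bar>g y\<bar> \<le> M"
  shows "\<bar>heat_conv \<tau> g x\<bar> \<le> M"
proof -
  have "\<bar>heat_conv \<tau> g x\<bar> \<le> (LINT y|lborel. \<bar>heat_kernel \<tau> (x - y) * g y\<bar>)"
    unfolding heat_conv_def using integral_norm_bound[of lborel "\<lambda>y. heat_kernel \<tau> (x - y) * g y"] by simp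
  also have "\<dots> \<le> (LINT y|lborel. M * heat_kernel \<tau> (x - y))"
  proof (rule integral_mono_AE)
    show "integrable lborel (\<lambda>y. \<bar>heat_kernel \<tau> (x - y) * g y\<bar>)"
      using heat_conv_integrable[OF \<tau> g M] by simp
    show "integrable lborel (\<lambda>y. M * heat_kernel \<tau> (x - y))"
      using heat_kernel_integrable_shift[OF \<tau>] by simp
    show "AE y in lborel. \<bar>heat_kernel \<tau> (x - y) * g y\<bar> \<le> M * heat_kernel \<tau> (x - y)"
      using M
    proof eventually_elim
      case (elim y)
      then have "\<bar>g y\<bar> * heat_kernel \<tau> (x - y) \<le> M * heat_kernel \<tau> (x - y)"
        by (intro mult_right_mono heat_kernel_nonneg)
      then show ?case by (simp add: abs_mult heat_kernel_nonneg mult.commute)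
    qed
  qed
  also have "\<dots> = M" by (simp add: integral_heat_kernel_shift[OF \<tau>])
  finally show ?thesis .
qed

lemma heat_conv_nonneg:
  assumes "AE y in lborel. 0 \<le> g y"
  shows "0 \<le> heat_conv \<tau> g x"
  unfolding heat_conv_def
  by (rule integral_nonneg_AE) (use assms in eventually_elim, simp add: heat_kernel_nonneg)

lemma heat_conv_cong_AE:
  assumes [measurable]: "f \<in> borel_measurable borel" "g \<in> borel_measurable borel"
    and "AE y in lborel. f y = g y"
  shows "heat_conv \<tau> f x = heat_conv \<tau> g x"
  unfolding heat_conv_def by (rule integral_cong_AE) (use assms(3) in auto)

text \<open>This form moves the translation from the kernel onto \<open>g\<close>, where periodicity
  and shifts of the column can act.\<close>

lemma heat_conv_reflect:
  assumes [measurable]: "g \<in> borel_measurable borel"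
  shows "heat_conv \<tau> g x = (LINT z|lborel. heat_kernel \<tau> z * g (x - z))"
    and "integrable lborel (\<lambda>z. heat_kernel \<tau> z * g (x - z)) \<longleftrightarrow>
      integrable lborel (\<lambda>y. heat_kernel \<tau> (x - y) * g y)"
  using integral_lborel_reflect[of "\<lambda>z. heat_kernel \<tau> z * g (x - z)" x]
  by (simp_all add: heat_conv_def)

lemma lat_periodic_heat_conv:
  assumes [measurable]: "g \<in> borel_measurable borel" and per: "lat_periodic p g"
  shows "lat_periodic p (heat_conv \<tau> g)"
proof -
  have "x + axis i (real p) - z = (x - z) + axis i (real p)" for x z :: "real^3" and i
    by simp
  then show ?thesis
    using per unfolding lat_periodic_def by (simp only: heat_conv_reflect(1)[OF assms(1)]) simp
qed

text \<open>Fubini's theorem reduces the iterated convolution to the semigroup property of the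
  kernel.\<close>

lemma heat_conv_compose:
  assumes \<tau>: "0 < \<tau>" and g [measurable]: "g \<in> borel_measurable borel"
    and M: "AE y in lborel. \<bar>g y\<bar> \<le> M"
  shows "heat_conv (\<tau>/2) (heat_conv (\<tau>/2) g) x = heat_conv \<tau> g x"
proof -
  have \<tau>': "0 < \<tau>/2" using \<tau> by simp
  let ?G = "heat_kernel (\<tau>/2)"
  let ?F = "\<lambda>z y. ?G (x - z) * (?G (z - y) * g y)"
  have M': "AE y in lborel. \<bar>\<bar>g y\<bar>\<bar> \<le> M" using M by simp
  have int: "integrable (lborel \<Otimes>\<^sub>M lborel) (\<lambda>(z, y). ?F z y)"
  proof (rule lborel_pair.Fubini_integrable)
    \<comment> \<open>Absolute integrability: the inner integral of absolute values is a convolution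
      of the absolute value of \<open>g\<close>, hence bounded by \<open>M\<close>, and the outer
      kernel is integrable.\<close>
    have "(LINT y|lborel. norm (?F z y)) = ?G (x - z) * heat_conv (\<tau>/2) (\<lambda>y. \<bar>g y\<bar>) z" for z
      by (simp add: heat_conv_def abs_mult heat_kernel_nonneg)
    moreover have "integrable lborel (\<lambda>z. ?G (x - z) * heat_conv (\<tau>/2) (\<lambda>y. \<bar>g y\<bar>) z)"
      by (rule heat_conv_integrable[OF \<tau>', where M = M])
        (use heat_conv_bound[OF \<tau>' _ M'] in auto)
    ultimately show "integrable lborel (\<lambda>z. LINT y|lborel. norm (case (z, y) of (z, y) \<Rightarrow> ?F z y))"
      by simp
    show "AE z in lborel. integrable lborel (\<lambda>y. case (z, y) of (z, y) \<Rightarrow> ?F z y)"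
      using heat_conv_integrable[OF \<tau>' g M] by simp
  qed measurable
  have "heat_conv (\<tau>/2) (heat_conv (\<tau>/2) g) x = (LINT z|lborel. LINT y|lborel. ?F z y)"
    by (simp add: heat_conv_def)
  also have "\<dots> = (LINT y|lborel. LINT z|lborel. ?F z y)"
    by (rule lborel_pair.Fubini_integral[symmetric]) (use int in simp)
  also have "\<dots> = (LINT y|lborel. (LINT z|lborel. ?G (x - z) * ?G (z - y)) * g y)"
    by (simp flip: mult.assoc)
  also have "\<dots> = heat_conv \<tau> g x"
    by (simp add: heat_kernel_semigroup[OF \<tau>] heat_conv_def)
  finally show ?thesis .
qed

section \<open>A class of periodic functions stable under convolution\<close>

text \<open>Two size conditions for two integrals: integrability over the column serves the outer
  integral, while the essential bound serves the convolution, which runs over the whole space, where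
  a nonzero periodic function need not be integrable.\<close>

definition cell_functions :: "nat \<Rightarrow> (real^3 \<Rightarrow> real) set" where
  "cell_functions p = {f. f \<in> borel_measurable borel \<and> lat_periodic p f \<and>
     set_integrable lborel (column p) f \<and> (\<exists>M. AE x in lborel. \<bar>f x\<bar> \<le> M)}"

lemma cell_functions_measurable: "f \<in> cell_functions p \<Longrightarrow> f \<in> borel_measurable borel"
  by (simp add: cell_functions_def)

lemma set_integrable_mult_bounded:
  fixes f g :: "'a \<Rightarrow> real"
  assumes f: "set_integrable N A f" and [measurable]: "g \<in> borel_measurable N"
    and M: "AE x in N. \<bar>g x\<bar> \<le> M"
  shows "set_integrable N A (\<lambda>x. f x * g x)"
  unfolding set_integrable_def
proof (rule Bochner_Integration.integrable_bound)
  have f': "integrable N (\<lambda>x. indicator A x * f x)"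
    using f by (simp add: set_integrable_def)
  then have [measurable]: "(\<lambda>x. indicator A x * f x) \<in> borel_measurable N"
    by (rule borel_measurable_integrable)
  show "integrable N (\<lambda>x. M * (indicator A x * f x))"
    using f' by simp
  \<comment> \<open>The grouping matters: measurability is known for \<open>f\<close> times the
    indicator of \<open>A\<close>, not for \<open>f\<close> itself.\<close>
  have "(\<lambda>x. (indicator A x * f x) * g x) \<in> borel_measurable N"
    by measurable
  then show "(\<lambda>x. indicator A x *\<^sub>R (f x * g x)) \<in> borel_measurable N"
    by (simp add: mult.assoc)
  show "AE x in N. norm (indicator A x *\<^sub>R (f x * g x)) \<le> norm (M * (indicator A x * f x))"
    using M
  proof eventually_elim
    case (elim x)
    then have "\<bar>g x\<bar> * \<bar>indicator A x * f x\<bar> \<le> \<bar>M\<bar> * \<bar>indicator A x * f x\<bar>"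
      by (intro mult_right_mono) auto
    then show ?case by (simp add: abs_mult mult_ac)
  qed
qed

lemma cell_functions_diff:
  assumes "f \<in> cell_functions p" "g \<in> cell_functions p"
  shows "(\<lambda>x. f x - g x) \<in> cell_functions p"
proof -
  obtain M N where "AE x in lborel. \<bar>f x\<bar> \<le> M" "AE x in lborel. \<bar>g x\<bar> \<le> N"
    using assms by (auto simp: cell_functions_def)
  then have "AE x in lborel. \<bar>f x - g x\<bar> \<le> M + N"
    by eventually_elim auto
  then show ?thesis
    using assms by (auto simp: cell_functions_def lat_periodic_def)
qed

lemma cell_functions_heat_conv:
  assumes \<tau>: "0 < \<tau>" and g: "g \<in> cell_functions p"
  shows "heat_conv \<tau> g \<in> cell_functions p"
proof -
  from g obtain M where [measurable]: "g \<in> borel_measurable borel" and per: "lat_periodic p g"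
    and int: "set_integrable lborel (column p) g" and M: "AE x in lborel. \<bar>g x\<bar> \<le> M"
    by (auto simp: cell_functions_def)
  let ?C = "indicator (column p) :: real^3 \<Rightarrow> ennreal"
  have eq: "ennreal (norm (indicator (column p) x *\<^sub>R y)) = ennreal \<bar>y\<bar> * ?C x" for x y
    by (auto split: split_indicator)
  have "(\<integral>\<^sup>+x. ennreal \<bar>heat_conv \<tau> g x\<bar> * ?C x \<partial>lborel) \<le>
      (\<integral>\<^sup>+x. (\<integral>\<^sup>+z. ennreal (heat_kernel \<tau> z) * (ennreal \<bar>g (x - z)\<bar> * ?C x) \<partial>lborel) \<partial>lborel)"
  proof (rule nn_integral_mono)
    fix x
    have "ennreal \<bar>heat_conv \<tau> g x\<bar> \<le> (\<integral>\<^sup>+z. ennreal \<bar>heat_kernel \<tau> z * g (x - z)\<bar> \<partial>lborel)"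
      using integral_norm_bound_ennreal[of lborel "\<lambda>z. heat_kernel \<tau> z * g (x - z)"]
        heat_conv_integrable[OF \<tau> _ M, of x] by (simp add: heat_conv_reflect)
    then have "ennreal \<bar>heat_conv \<tau> g x\<bar> * ?C x \<le>
        (\<integral>\<^sup>+z. ennreal \<bar>heat_kernel \<tau> z * g (x - z)\<bar> \<partial>lborel) * ?C x"
      by (rule mult_right_mono) simp
    also have "\<dots> = (\<integral>\<^sup>+z. ennreal \<bar>heat_kernel \<tau> z * g (x - z)\<bar> * ?C x \<partial>lborel)"
      by (rule nn_integral_multc[symmetric]) measurable
    finally show "ennreal \<bar>heat_conv \<tau> g x\<bar> * ?C x \<le>
        (\<integral>\<^sup>+z. ennreal (heat_kernel \<tau> z) * (ennreal \<bar>g (x - z)\<bar> * ?C x) \<partial>lborel)"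
      by (simp add: abs_mult ennreal_mult heat_kernel_nonneg mult.assoc)
  qed
  also have "\<dots> = (\<integral>\<^sup>+z. (\<integral>\<^sup>+x. ennreal (heat_kernel \<tau> z) * (ennreal \<bar>g (x - z)\<bar> * ?C x) \<partial>lborel) \<partial>lborel)"
    by (rule lborel_pair.Fubini') measurable
  also have "\<dots> = (\<integral>\<^sup>+z. ennreal (heat_kernel \<tau> z) * (\<integral>\<^sup>+x. ennreal \<bar>g x\<bar> * ?C x \<partial>lborel) \<partial>lborel)"
  proof (rule nn_integral_cong)
    fix z
    have "(\<integral>\<^sup>+x. ennreal \<bar>g (x - z)\<bar> * ?C x \<partial>lborel) = (\<integral>\<^sup>+x. ennreal \<bar>g x\<bar> * ?C x \<partial>lborel)"
      using nn_integral_column_shift[of "\<lambda>x. ennreal \<bar>g x\<bar>" p "- z"]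
        lat_periodic_compose[OF per, of "\<lambda>t. ennreal \<bar>t\<bar>"] by simp
    then show "(\<integral>\<^sup>+x. ennreal (heat_kernel \<tau> z) * (ennreal \<bar>g (x - z)\<bar> * ?C x) \<partial>lborel) =
        ennreal (heat_kernel \<tau> z) * (\<integral>\<^sup>+x. ennreal \<bar>g x\<bar> * ?C x \<partial>lborel)"
      by (subst nn_integral_cmult) auto
  qed
  also have "\<dots> = (\<integral>\<^sup>+x. ennreal \<bar>g x\<bar> * ?C x \<partial>lborel)"
    by (simp add: nn_integral_multc nn_integral_heat_kernel[OF \<tau>])
  also have "\<dots> < \<infinity>"
    using int unfolding set_integrable_def integrable_iff_bounded eq by simp
  finally have "set_integrable lborel (column p) (heat_conv \<tau> g)"
    unfolding set_integrable_def integrable_iff_bounded eq by simp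
  then show ?thesis
    using heat_conv_bound[OF \<tau> _ M] lat_periodic_heat_conv[OF _ per]
    by (auto simp: cell_functions_def)
qed

lemma set_integrable_mult_cell_functions:
  assumes "f \<in> cell_functions p" "g \<in> cell_functions p"
  shows "set_integrable lborel (column p) (\<lambda>x. f x * g x)"
  using assms by (auto simp: cell_functions_def intro: set_integrable_mult_bounded)

section \<open>The heat bilinear form: symmetry and positivity\<close>

definition heat_form :: "nat \<Rightarrow> real \<Rightarrow> (real^3 \<Rightarrow> real) \<Rightarrow> (real^3 \<Rightarrow> real) \<Rightarrow> real" where
  "heat_form p \<tau> f g = (LINT x:column p|lborel. f x * heat_conv \<tau> g x)"

text \<open>Fubini's theorem writes the form as a kernel-weighted mean of correlations of
  \<open>f\<close> with translates of \<open>g\<close>; symmetry is then a question about each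
  correlation.\<close>

lemma heat_form_swap:
  assumes \<tau>: "0 < \<tau>" and f: "f \<in> cell_functions p" and g: "g \<in> cell_functions p"
  shows "heat_form p \<tau> f g = (LINT z|lborel. heat_kernel \<tau> z * (LINT x:column p|lborel. f x * g (x - z)))"
proof -
  from f have [measurable]: "f \<in> borel_measurable borel" and intf: "set_integrable lborel (column p) f"
    by (auto simp: cell_functions_def)
  from g obtain M where [measurable]: "g \<in> borel_measurable borel" and M: "AE x in lborel. \<bar>g x\<bar> \<le> M"
    by (auto simp: cell_functions_def)
  have M': "AE y in lborel. \<bar>\<bar>g y\<bar>\<bar> \<le> M" using M by simp
  let ?F = "\<lambda>x z. (indicator (column p) x * f x) * (heat_kernel \<tau> z * g (x - z))"
  have int: "integrable (lborel \<Otimes>\<^sub>M lborel) (\<lambda>(x, z). ?F x z)"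
  proof (rule lborel_pair.Fubini_integrable)
    \<comment> \<open>Absolute integrability: the inner integral is the absolute value of
      \<open>f\<close> times a bounded convolution, restricted to the column.\<close>
    have "(LINT z|lborel. norm (?F x z)) = indicator (column p) x *\<^sub>R (\<bar>f x\<bar> * heat_conv \<tau> (\<lambda>y. \<bar>g y\<bar>) x)" for x
      by (simp add: heat_conv_reflect abs_mult heat_kernel_nonneg)
    moreover have "set_integrable lborel (column p) (\<lambda>x. \<bar>f x\<bar> * heat_conv \<tau> (\<lambda>y. \<bar>g y\<bar>) x)"
      by (rule set_integrable_mult_bounded[where M = M])
        (use heat_conv_bound[OF \<tau> _ M'] set_integrable_abs[OF intf] in auto)
    ultimately show "integrable lborel (\<lambda>x. LINT z|lborel. norm (case (x, z) of (x, z) \<Rightarrow> ?F x z))"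
      by (simp add: set_integrable_def)
    show "AE x in lborel. integrable lborel (\<lambda>z. case (x, z) of (x, z) \<Rightarrow> ?F x z)"
      using heat_conv_integrable[OF \<tau> _ M] by (simp add: heat_conv_reflect(2))
  qed measurable
  have "heat_form p \<tau> f g = (LINT x|lborel. LINT z|lborel. ?F x z)"
    by (simp add: heat_form_def set_lebesgue_integral_def heat_conv_reflect(1) mult.assoc)
  also have "\<dots> = (LINT z|lborel. LINT x|lborel. ?F x z)"
    by (rule lborel_pair.Fubini_integral[symmetric]) (use int in simp)
  also have "\<dots> = (LINT z|lborel. LINT x|lborel. heat_kernel \<tau> z * (indicator (column p) x * (f x * g (x - z))))"
    by (simp add: mult_ac)
  also have "\<dots> = (LINT z|lborel. heat_kernel \<tau> z * (LINT x:column p|lborel. f x * g (x - z)))"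
    by (simp add: set_lebesgue_integral_def)
  finally show ?thesis .
qed

text \<open>The kernel is even, so \<open>z\<close> may change sign, and shifting the fundamental
  domain moves the translation from \<open>g\<close> to \<open>f\<close>.\<close>

lemma heat_form_commute:
  assumes \<tau>: "0 < \<tau>" and f: "f \<in> cell_functions p" and g: "g \<in> cell_functions p"
  shows "heat_form p \<tau> f g = heat_form p \<tau> g f"
proof -
  from f have mf [measurable]: "f \<in> borel_measurable borel" and intf: "set_integrable lborel (column p) f"
      and perf: "lat_periodic p f"
    by (auto simp: cell_functions_def)
  from g obtain M where [measurable]: "g \<in> borel_measurable borel" and perg: "lat_periodic p g"
      and M: "AE x in lborel. \<bar>g x\<bar> \<le> M"
    by (auto simp: cell_functions_def)
  \<comment> \<open>Column invariance is applied to the periodic product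
    \<open>f (x - z) * g x\<close>, whose translate by \<open>z\<close> is
    \<open>f x * g (x + z)\<close>.\<close>
  have shift: "(LINT x:column p|lborel. f x * g (x + z)) = (LINT x:column p|lborel. g x * f (x - z))" for z
  proof -
    have 1: "set_integrable lborel (column p) (\<lambda>x. f (x + - z))"
      by (rule set_integrable_column_shift(1)[OF mf perf intf])
    have 2: "set_integrable lborel (column p) (\<lambda>x. f (x + - z) * g x)"
      by (rule set_integrable_mult_bounded[OF 1 _ M]) simp
    have 3: "lat_periodic p (\<lambda>x. f (x + - z) * g x)"
      using lat_periodic_shift[OF perf, of "- z"] perg by (simp add: lat_periodic_def)
    show ?thesis
      using set_integrable_column_shift(2)[OF _ 3 2, of z] by (simp add: mult.commute)
  qed
  have "heat_form p \<tau> f g = (LINT z|lborel. heat_kernel \<tau> z * (LINT x:column p|lborel. f x * g (x - z)))"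
    by (rule heat_form_swap[OF assms])
  also have "\<dots> = (LINT z|lborel. heat_kernel \<tau> z * (LINT x:column p|lborel. f x * g (x + z)))"
    using integral_lborel_reflect(1)[of "\<lambda>z. heat_kernel \<tau> z * (LINT x:column p|lborel. f x * g (x - z))" 0]
    by (simp add: heat_kernel_minus set_lebesgue_integral_def)
  also have "\<dots> = heat_form p \<tau> g f"
    unfolding shift by (rule heat_form_swap[OF \<tau> g f, symmetric])
  finally show ?thesis .
qed

text \<open>The semigroup property splits the convolution into two of time \<open>\<tau>/2\<close>;
  symmetry of the half-time form moves one of them onto the other argument, leaving the integral of
  a square.\<close>

lemma heat_form_nonneg:
  assumes \<tau>: "0 < \<tau>" and f: "f \<in> cell_functions p"
  shows "0 \<le> heat_form p \<tau> f f"
proof -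
  have \<tau>': "0 < \<tau>/2" using \<tau> by simp
  let ?w = "heat_conv (\<tau>/2) f"
  obtain M where "f \<in> borel_measurable borel" "AE x in lborel. \<bar>f x\<bar> \<le> M"
    using f by (auto simp: cell_functions_def)
  then have "heat_form p \<tau> f f = heat_form p (\<tau>/2) f ?w"
    using heat_conv_compose[OF \<tau>] by (simp add: heat_form_def)
  also have "\<dots> = heat_form p (\<tau>/2) ?w f"
    by (intro heat_form_commute \<tau>' f cell_functions_heat_conv)
  also have "\<dots> = (LINT x|lborel. indicator (column p) x * (?w x * ?w x))"
    by (simp add: heat_form_def set_lebesgue_integral_def)
  also have "\<dots> \<ge> 0" by (rule Bochner_Integration.integral_nonneg) simp
  finally show ?thesis .
qed

lemma heat_conv_diff:
  assumes \<tau>: "0 < \<tau>" and "f \<in> cell_functions p" "g \<in> cell_functions p"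
  shows "heat_conv \<tau> (\<lambda>x. f x - g x) x = heat_conv \<tau> f x - heat_conv \<tau> g x"
proof -
  have "integrable lborel (\<lambda>y. heat_kernel \<tau> (x - y) * f y)"
    "integrable lborel (\<lambda>y. heat_kernel \<tau> (x - y) * g y)"
    using assms heat_conv_integrable[OF \<tau>] by (auto simp: cell_functions_def)
  then show ?thesis
    by (simp add: heat_conv_def right_diff_distrib)
qed

lemma heat_form_integrable:
  assumes "0 < \<tau>" "f \<in> cell_functions p" "g \<in> cell_functions p"
  shows "set_integrable lborel (column p) (\<lambda>x. f x * heat_conv \<tau> g x)"
  using assms by (intro set_integrable_mult_cell_functions cell_functions_heat_conv)

lemma heat_form_diff_left:
  assumes "0 < \<tau>" "f \<in> cell_functions p" "f' \<in> cell_functions p" "g \<in> cell_functions p"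
  shows "heat_form p \<tau> (\<lambda>x. f x - f' x) g = heat_form p \<tau> f g - heat_form p \<tau> f' g"
  using set_integral_diff(2)[OF heat_form_integrable heat_form_integrable] assms
  by (simp add: heat_form_def left_diff_distrib)

lemma heat_form_diff_right:
  assumes "0 < \<tau>" "f \<in> cell_functions p" "g \<in> cell_functions p" "g' \<in> cell_functions p"
  shows "heat_form p \<tau> f (\<lambda>x. g x - g' x) = heat_form p \<tau> f g - heat_form p \<tau> f g'"
  using set_integral_diff(2)[OF heat_form_integrable heat_form_integrable] assms
  by (simp add: heat_form_def heat_conv_diff right_diff_distrib)

text \<open>Convolution ignores null sets, so almost everywhere opposite functions have opposite
  convolutions at every point, and the form becomes minus its value on the diagonal.\<close>

lemma heat_form_opposite_nonpos:
  assumes \<tau>: "0 < \<tau>" and f: "f \<in> cell_functions p" and g: "g \<in> cell_functions p"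
    and opp: "AE x in lborel. g x = - f x"
  shows "heat_form p \<tau> f g \<le> 0"
proof -
  have "heat_conv \<tau> g x = - heat_conv \<tau> f x" for x
  proof -
    have "heat_conv \<tau> g x = heat_conv \<tau> (\<lambda>x. - f x) x"
      using opp cell_functions_measurable[OF f] cell_functions_measurable[OF g]
      by (intro heat_conv_cong_AE) auto
    then show ?thesis by (simp add: heat_conv_def)
  qed
  then have "heat_form p \<tau> f g = - heat_form p \<tau> f f"
    by (simp add: heat_form_def set_lebesgue_integral_def)
  then show ?thesis using heat_form_nonneg[OF \<tau> f] by simp
qed

section \<open>Energy and linearized functional of admissible pairs as real expressions\<close>

lemma solid_measurable:
  assumes [measurable]: "\<psi> \<in> borel_measurable borel"
  shows "solid \<psi> \<in> sets borel"
proof -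
  have [measurable]: "(\<lambda>x::real^3. \<psi> (x$1, x$2)) \<in> borel_measurable borel"
    by (rule measurable_compose[OF borel_measurable_Pair assms]) simp_all
  have "{x \<in> space borel. x$3 \<le> \<psi> (x$1, x$2)} \<in> sets borel"
    by measurable
  then show ?thesis by (simp add: solid_def)
qed

text \<open>Extension by zero carries the bounds from the fluid region to the whole space and makes
  integrability over the fluid part of a column the same as integrability over the column.\<close>

lemma admissible_cell_functions:
  assumes "(u1, u2) \<in> admissible p \<psi> c r R"
  shows "u1 \<in> cell_functions p" and "u2 \<in> cell_functions p"
    and "AE x in lborel. 0 \<le> u1 x" and "AE x in lborel. 0 \<le> u2 x"
    and "AE x in lborel. x \<in> fluid \<psi> c r R \<longrightarrow> u1 x + u2 x = 1"
    and "\<And>x. x \<notin> fluid \<psi> c r R \<Longrightarrow> u1 x = 0" and "\<And>x. x \<notin> fluid \<psi> c r R \<Longrightarrow> u2 x = 0"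
proof -
  from assms have bv: "u1 \<in> BV p (fluid \<psi> c r R)" "u2 \<in> BV p (fluid \<psi> c r R)"
    and ae: "AE x in lborel. x \<in> fluid \<psi> c r R \<longrightarrow> u1 x \<in> {0..1} \<and> u2 x \<in> {0..1} \<and> u1 x + u2 x = 1"
    and z: "\<And>x. x \<notin> fluid \<psi> c r R \<Longrightarrow> u1 x = 0 \<and> u2 x = 0"
    by (auto simp: admissible_def)
  show "\<And>x. x \<notin> fluid \<psi> c r R \<Longrightarrow> u1 x = 0" "\<And>x. x \<notin> fluid \<psi> c r R \<Longrightarrow> u2 x = 0"
    using z by auto
  have 01: "AE x in lborel. u1 x \<in> {0..1} \<and> u2 x \<in> {0..1}"
    using ae
  proof eventually_elim
    case (elim x)
    then show ?case using z[of x] by (cases "x \<in> fluid \<psi> c r R") auto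
  qed
  show "AE x in lborel. 0 \<le> u1 x" "AE x in lborel. 0 \<le> u2 x"
    using 01 by auto
  show "AE x in lborel. x \<in> fluid \<psi> c r R \<longrightarrow> u1 x + u2 x = 1"
    using ae by auto
  have cell: "u \<in> cell_functions p" if u: "u \<in> BV p (fluid \<psi> c r R)" "AE x in lborel. u x \<in> {0..1}"
    and zu: "\<And>x. x \<notin> fluid \<psi> c r R \<Longrightarrow> u x = 0" for u
  proof -
    have "(\<lambda>x. indicator (fluid \<psi> c r R \<inter> column p) x *\<^sub>R u x) = (\<lambda>x. indicator (column p) x *\<^sub>R u x)"
      using zu by (auto simp: fun_eq_iff split: split_indicator)
    then have "set_integrable lborel (column p) u"
      using u(1) by (simp add: BV_def set_integrable_def)
    moreover have "AE x in lborel. \<bar>u x\<bar> \<le> 1"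
      using u(2) by auto
    ultimately show ?thesis
      using u(1) by (auto simp: BV_def cell_functions_def)
  qed
  show "u1 \<in> cell_functions p" "u2 \<in> cell_functions p"
    using cell[OF bv(1)] cell[OF bv(2)] 01 z by auto
qed

lemma cell_functions_mult_bounded_integrable:
  assumes "f \<in> cell_functions p" and "h \<in> borel_measurable borel" and "\<And>x. \<bar>h x\<bar> \<le> K"
  shows "set_integrable lborel (column p) (\<lambda>x. f x * h x)"
  using assms by (auto simp: cell_functions_def intro!: set_integrable_mult_bounded)

text \<open>\<open>Omega_bar\<close> contains the fluid region, outside which \<open>f\<close>
  vanishes, so only the column remains as a restriction; nonnegativity almost everywhere then
  identifies the two kinds of integral.\<close>

lemma nn_integral_Omega_bar_column:
  assumes f: "f \<in> cell_functions p" and pos: "AE x in lborel. 0 \<le> f x"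
    and z: "\<And>x. x \<notin> fluid \<psi> c r R \<Longrightarrow> f x = 0"
    and h: "h \<in> borel_measurable borel" "\<And>x. \<bar>h x\<bar> \<le> K" "\<And>x. 0 \<le> h x"
  shows "(\<integral>\<^sup>+x\<in>Omega_bar \<psi> c r R \<inter> column p. ennreal (f x * h x) \<partial>lborel) =
      ennreal (LINT x:column p|lborel. f x * h x)"
    and "0 \<le> (LINT x:column p|lborel. f x * h x)"
proof -
  have nn: "AE x in lborel. 0 \<le> indicator (column p) x *\<^sub>R (f x * h x)"
    using pos by eventually_elim (simp add: h)
  have "ennreal (f x * h x) * indicator (Omega_bar \<psi> c r R \<inter> column p) x =
      ennreal (indicator (column p) x *\<^sub>R (f x * h x))" for x
    using z[of x] by (auto simp: Omega_bar_def fluid_def split: split_indicator)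
  then show "(\<integral>\<^sup>+x\<in>Omega_bar \<psi> c r R \<inter> column p. ennreal (f x * h x) \<partial>lborel) =
      ennreal (LINT x:column p|lborel. f x * h x)"
    using nn_integral_eq_integral[OF _ nn] cell_functions_mult_bounded_integrable[OF f h(1,2)]
    by (simp add: set_integrable_def set_lebesgue_integral_def)
  show "0 \<le> (LINT x:column p|lborel. f x * h x)"
    unfolding set_lebesgue_integral_def by (rule integral_nonneg_AE[OF nn])
qed

text \<open>Kept apart from \<open>heat_form\<close> because the solid is unbounded below: its
  indicator is not integrable over a column and lies outside \<open>cell_functions p\<close>. Its
  convolution is still bounded, which makes the integral linear in \<open>f\<close>.\<close>

definition solid_form :: "nat \<Rightarrow> real \<Rightarrow> (real \<times> real \<Rightarrow> real) \<Rightarrow> (real^3 \<Rightarrow> real) \<Rightarrow> real" where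
  "solid_form p \<tau> \<psi> f = (LINT x:column p|lborel. f x * heat_conv \<tau> (indicator (solid \<psi>)) x)"

lemma heat_conv_solid:
  assumes "\<psi> \<in> borel_measurable borel" and "0 < \<tau>"
  shows "heat_conv \<tau> (indicator (solid \<psi>)) \<in> borel_measurable borel"
    and "\<bar>heat_conv \<tau> (indicator (solid \<psi>)) x\<bar> \<le> 1"
    and "0 \<le> heat_conv \<tau> (indicator (solid \<psi>)) x"
proof -
  have m: "(indicator (solid \<psi>) :: real^3 \<Rightarrow> real) \<in> borel_measurable borel"
    using solid_measurable[OF assms(1)] by simp
  show "heat_conv \<tau> (indicator (solid \<psi>)) \<in> borel_measurable borel"
    using m by (rule heat_conv_measurable)
  show "\<bar>heat_conv \<tau> (indicator (solid \<psi>)) x\<bar> \<le> 1"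
    by (rule heat_conv_bound[OF assms(2) m]) (auto simp: indicator_def)
  show "0 \<le> heat_conv \<tau> (indicator (solid \<psi>)) x"
    by (rule heat_conv_nonneg) simp
qed

lemma solid_form_diff:
  assumes "\<psi> \<in> borel_measurable borel" and "0 < \<tau>" and "f \<in> cell_functions p" "g \<in> cell_functions p"
  shows "solid_form p \<tau> \<psi> (\<lambda>x. f x - g x) = solid_form p \<tau> \<psi> f - solid_form p \<tau> \<psi> g"
  using set_integral_diff(2)[OF cell_functions_mult_bounded_integrable[OF assms(3) heat_conv_solid(1,2)[OF assms(1,2)]]
      cell_functions_mult_bounded_integrable[OF assms(4) heat_conv_solid(1,2)[OF assms(1,2)]]]
  by (simp add: solid_form_def left_diff_distrib)

text \<open>Passing from \<open>ennreal\<close> to real forms makes subtraction available, which the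
  comparison of two energies needs.\<close>

lemma energy_eq:
  assumes \<psi>: "\<psi> \<in> borel_measurable borel" and \<tau>: "0 < \<tau>1" "0 < \<tau>2"
    and \<gamma>: "0 \<le> \<gamma>LV" "0 \<le> \<gamma>SL" "0 \<le> \<gamma>SV"
    and adm: "(u1, u2) \<in> admissible p \<psi> c r R"
  shows "energy p \<psi> c r R \<gamma>LV \<gamma>SL \<gamma>SV \<tau>1 \<tau>2 u1 u2 = ennreal (sqrt pi *
    (\<gamma>LV / sqrt \<tau>1 * heat_form p \<tau>1 u1 u2 + \<gamma>SL / sqrt \<tau>2 * solid_form p \<tau>2 \<psi> u1
      + \<gamma>SV / sqrt \<tau>2 * solid_form p \<tau>2 \<psi> u2))"
proof -
  note a = admissible_cell_functions[OF adm]
  obtain M where M: "\<And>x. \<bar>heat_conv \<tau>1 u2 x\<bar> \<le> M"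
    using a(2) heat_conv_bound[OF \<tau>(1)] unfolding cell_functions_def by blast
  let ?I = "\<lambda>f h. (\<integral>\<^sup>+x\<in>Omega_bar \<psi> c r R \<inter> column p. ennreal (f x * h x) \<partial>lborel)"
  have LV: "?I u1 (heat_conv \<tau>1 u2) = ennreal (heat_form p \<tau>1 u1 u2)" "0 \<le> heat_form p \<tau>1 u1 u2"
    unfolding heat_form_def
    by - (rule nn_integral_Omega_bar_column[where \<psi> = \<psi> and c = c and r = r and R = R, OF a(1,3) _ _ M];
        simp add: a heat_conv_nonneg heat_conv_measurable cell_functions_measurable[OF a(2)])+
  have S: "?I f (heat_conv \<tau>2 (indicator (solid \<psi>))) = ennreal (solid_form p \<tau>2 \<psi> f)"
    "0 \<le> solid_form p \<tau>2 \<psi> f"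
    if "f \<in> cell_functions p" "AE x in lborel. 0 \<le> f x" "\<forall>x. x \<notin> fluid \<psi> c r R \<longrightarrow> f x = 0" for f
    unfolding solid_form_def
    by - (rule nn_integral_Omega_bar_column[where \<psi> = \<psi> and c = c and r = r and R = R, OF that(1,2) _ heat_conv_solid[OF \<psi> \<tau>(2)]]; simp add: that)+
  have z: "\<forall>x. x \<notin> fluid \<psi> c r R \<longrightarrow> u1 x = 0" "\<forall>x. x \<notin> fluid \<psi> c r R \<longrightarrow> u2 x = 0"
    using a(6,7) by auto
  have sum: "ennreal A * ennreal X + ennreal B * ennreal Y + ennreal C * ennreal Z = ennreal (A * X + B * Y + C * Z)"
    if "0 \<le> A" "0 \<le> B" "0 \<le> C" "0 \<le> X" "0 \<le> Y" "0 \<le> Z" for A B C X Y Z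
    using that by (simp add: ennreal_mult)
  have "energy p \<psi> c r R \<gamma>LV \<gamma>SL \<gamma>SV \<tau>1 \<tau>2 u1 u2 =
      ennreal (sqrt pi * \<gamma>LV / sqrt \<tau>1) * ennreal (heat_form p \<tau>1 u1 u2) +
      ennreal (sqrt pi * \<gamma>SL / sqrt \<tau>2) * ennreal (solid_form p \<tau>2 \<psi> u1) +
      ennreal (sqrt pi * \<gamma>SV / sqrt \<tau>2) * ennreal (solid_form p \<tau>2 \<psi> u2)"
    unfolding energy_def LV(1) S(1)[OF a(1,3) z(1)] S(1)[OF a(2,4) z(2)] by (rule refl)
  also have "\<dots> = ennreal (sqrt pi * \<gamma>LV / sqrt \<tau>1 * heat_form p \<tau>1 u1 u2 +
      sqrt pi * \<gamma>SL / sqrt \<tau>2 * solid_form p \<tau>2 \<psi> u1 +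
      sqrt pi * \<gamma>SV / sqrt \<tau>2 * solid_form p \<tau>2 \<psi> u2)"
    by (rule sum) (use LV(2) S(2)[OF a(1,3) z(1)] S(2)[OF a(2,4) z(2)] \<gamma> \<tau> in auto)
  also have "sqrt pi * \<gamma>LV / sqrt \<tau>1 * heat_form p \<tau>1 u1 u2 +
      sqrt pi * \<gamma>SL / sqrt \<tau>2 * solid_form p \<tau>2 \<psi> u1 +
      sqrt pi * \<gamma>SV / sqrt \<tau>2 * solid_form p \<tau>2 \<psi> u2 = sqrt pi *
    (\<gamma>LV / sqrt \<tau>1 * heat_form p \<tau>1 u1 u2 + \<gamma>SL / sqrt \<tau>2 * solid_form p \<tau>2 \<psi> u1
      + \<gamma>SV / sqrt \<tau>2 * solid_form p \<tau>2 \<psi> u2)"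
    by (simp add: algebra_simps)
  finally show ?thesis .
qed

lemma set_integral_Omega_bar_column_linear:
  assumes \<psi>: "\<psi> \<in> borel_measurable borel" and \<tau>: "0 < \<tau>1" "0 < \<tau>2"
    and f: "f \<in> cell_functions p" and g: "g \<in> cell_functions p"
    and z: "\<And>x. x \<notin> fluid \<psi> c r R \<Longrightarrow> f x = 0"
  shows "(LINT x:Omega_bar \<psi> c r R \<inter> column p|lborel.
      f x * (a * heat_conv \<tau>1 g x + b * heat_conv \<tau>2 (indicator (solid \<psi>)) x)) =
    a * heat_form p \<tau>1 f g + b * solid_form p \<tau>2 \<psi> f"
proof -
  have i: "integrable lborel (\<lambda>x. indicator (column p) x * (f x * heat_conv \<tau>1 g x))"
    "integrable lborel (\<lambda>x. indicator (column p) x * (f x * heat_conv \<tau>2 (indicator (solid \<psi>)) x))"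
    using heat_form_integrable[OF \<tau>(1) f g]
      cell_functions_mult_bounded_integrable[OF f heat_conv_solid(1,2)[OF \<psi> \<tau>(2)]]
    by (simp_all add: set_integrable_def)
  have "indicator (Omega_bar \<psi> c r R \<inter> column p) x *\<^sub>R
      (f x * (a * heat_conv \<tau>1 g x + b * heat_conv \<tau>2 (indicator (solid \<psi>)) x)) =
      a * (indicator (column p) x * (f x * heat_conv \<tau>1 g x)) +
      b * (indicator (column p) x * (f x * heat_conv \<tau>2 (indicator (solid \<psi>)) x))" for x
    using z[of x] by (auto simp: Omega_bar_def fluid_def algebra_simps split: split_indicator)
  then show ?thesis
    using i by (simp add: set_lebesgue_integral_def heat_form_def solid_form_def)
qed

lemma lin_functional_eq:
  assumes \<psi>: "\<psi> \<in> borel_measurable borel" and \<tau>: "0 < \<tau>1" "0 < \<tau>2"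
    and "v1 \<in> cell_functions p" "v2 \<in> cell_functions p" "w1 \<in> cell_functions p" "w2 \<in> cell_functions p"
    and "\<And>x. x \<notin> fluid \<psi> c r R \<Longrightarrow> v1 x = 0" "\<And>x. x \<notin> fluid \<psi> c r R \<Longrightarrow> v2 x = 0"
  shows "lin_functional p \<psi> c r R \<gamma>LV \<gamma>SL \<gamma>SV \<tau>1 \<tau>2 v1 v2 w1 w2 = sqrt pi *
    (\<gamma>LV / sqrt \<tau>1 * (heat_form p \<tau>1 v1 w2 + heat_form p \<tau>1 v2 w1)
      + \<gamma>SL / sqrt \<tau>2 * solid_form p \<tau>2 \<psi> v1 + \<gamma>SV / sqrt \<tau>2 * solid_form p \<tau>2 \<psi> v2)"
  unfolding lin_functional_def
  by (subst (1 2) set_integral_Omega_bar_column_linear[where \<psi> = \<psi> and c = c and r = r and R = R])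
    (use assms in \<open>auto simp: algebra_simps\<close>)

section \<open>Energy decrease in a single linearized step\<close>

text \<open>Between admissible pairs the energy is concave, so it lies below its tangent at
  \<open>u\<close>; the linearized functional of \<open>w - u\<close> is the increment along that
  tangent.\<close>

lemma energy_le_of_lin_functional_nonpos:
  assumes \<psi>: "\<psi> \<in> borel_measurable borel" and \<tau>: "0 < \<tau>1" "0 < \<tau>2"
    and \<gamma>: "0 \<le> \<gamma>LV" "0 \<le> \<gamma>SL" "0 \<le> \<gamma>SV"
    and u: "(u1, u2) \<in> admissible p \<psi> c r R" and w: "(w1, w2) \<in> admissible p \<psi> c r R"
    and lin: "lin_functional p \<psi> c r R \<gamma>LV \<gamma>SL \<gamma>SV \<tau>1 \<tau>2
        (\<lambda>x. w1 x - u1 x) (\<lambda>x. w2 x - u2 x) u1 u2 \<le> 0"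
  shows "energy p \<psi> c r R \<gamma>LV \<gamma>SL \<gamma>SV \<tau>1 \<tau>2 w1 w2 \<le> energy p \<psi> c r R \<gamma>LV \<gamma>SL \<gamma>SV \<tau>1 \<tau>2 u1 u2"
proof -
  note au = admissible_cell_functions[OF u] and aw = admissible_cell_functions[OF w]
  let ?H = "heat_form p \<tau>1"
  let ?S = "solid_form p \<tau>2 \<psi>"
  \<comment> \<open>Both pairs sum to 1 on the fluid region and vanish off it, so the increments of
    the two components cancel.\<close>
  have opp: "AE x in lborel. w2 x - u2 x = - (w1 x - u1 x)"
    using au(5) aw(5)
  proof eventually_elim
    case (elim x)
    then show ?case using au(6,7)[of x] aw(6,7)[of x] by (cases "x \<in> fluid \<psi> c r R") auto
  qed
  have "?H (\<lambda>x. w1 x - u1 x) (\<lambda>x. w2 x - u2 x) \<le> 0"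
    by (intro heat_form_opposite_nonpos \<tau> opp cell_functions_diff au aw)
  moreover have "?H (\<lambda>x. w1 x - u1 x) (\<lambda>x. w2 x - u2 x) = ?H w1 w2 - ?H w1 u2 - (?H u1 w2 - ?H u1 u2)"
    using au(1,2) aw(1,2) \<tau>(1)
    by (simp add: heat_form_diff_left heat_form_diff_right cell_functions_diff)
  \<comment> \<open>Symmetry puts the old iterate under the convolution in every mixed term, as in
    the linearized functional.\<close>
  moreover have "?H u1 w2 = ?H w2 u1" "?H u1 u2 = ?H u2 u1"
    by (intro heat_form_commute \<tau> au aw)+
  ultimately have "?H w1 w2 - ?H u1 u2 \<le> (?H w1 u2 - ?H u1 u2) + (?H w2 u1 - ?H u2 u1)"
    by linarith
  then have "\<gamma>LV / sqrt \<tau>1 * (?H w1 w2 - ?H u1 u2) \<le>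
      \<gamma>LV / sqrt \<tau>1 * ((?H w1 u2 - ?H u1 u2) + (?H w2 u1 - ?H u2 u1))"
    using \<gamma> \<tau> by (intro mult_left_mono) auto
  moreover have "\<gamma>LV / sqrt \<tau>1 * ((?H w1 u2 - ?H u1 u2) + (?H w2 u1 - ?H u2 u1)) +
      \<gamma>SL / sqrt \<tau>2 * (?S w1 - ?S u1) + \<gamma>SV / sqrt \<tau>2 * (?S w2 - ?S u2) \<le> 0" (is "?L \<le> 0")
  proof -
    have "lin_functional p \<psi> c r R \<gamma>LV \<gamma>SL \<gamma>SV \<tau>1 \<tau>2
        (\<lambda>x. w1 x - u1 x) (\<lambda>x. w2 x - u2 x) u1 u2 = sqrt pi * ?L"
      using au(1,2,6,7) aw(1,2,6,7) \<tau>
      by (subst lin_functional_eq[OF \<psi> \<tau>])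
        (simp_all add: cell_functions_diff heat_form_diff_left solid_form_diff[OF \<psi>])
    then have "sqrt pi * ?L \<le> sqrt pi * 0" using lin by simp
    then show ?thesis by (rule mult_left_le_imp_le) simp
  qed
  ultimately have "\<gamma>LV / sqrt \<tau>1 * ?H w1 w2 + \<gamma>SL / sqrt \<tau>2 * ?S w1 + \<gamma>SV / sqrt \<tau>2 * ?S w2 \<le>
      \<gamma>LV / sqrt \<tau>1 * ?H u1 u2 + \<gamma>SL / sqrt \<tau>2 * ?S u1 + \<gamma>SV / sqrt \<tau>2 * ?S u2"
    unfolding right_diff_distrib by linarith
  then show ?thesis
    unfolding energy_eq[OF \<psi> \<tau> \<gamma> u] energy_eq[OF \<psi> \<tau> \<gamma> w]
    by (intro ennreal_leI mult_left_mono) auto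
qed

text \<open>On \<open>[0, pi]\<close> the cosine vanishes only at \<open>pi / 2\<close>, where the
  limit value is used; elsewhere the quotient is nonzero and its square is positive.\<close>

lemma tau2_of_pos:
  assumes "0 \<le> \<theta>" "\<theta> \<le> pi" "0 < \<tau>"
  shows "0 < tau2_of \<theta> \<tau>"
proof (cases "\<theta> = pi / 2")
  case False
  have "cos \<theta> \<noteq> 0"
  proof
    assume "cos \<theta> = 0"
    then have "cos \<theta> = cos (pi / 2)" by simp
    then show False using cos_inj_pi[of \<theta> "pi / 2"] assms False by simp
  qed
  then show ?thesis using False assms by (auto simp: tau2_of_def field_simps)
qed (use assms in \<open>simp add: tau2_of_def\<close>)

section \<open>Energy decay along the alternating iteration\<close>

theorem theorem3:
  fixes \<psi> :: "real \<times> real \<Rightarrow> real"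
    and r R c \<gamma>LV \<gamma>SL \<gamma>SV \<theta>Y \<tau>1 \<tau>2 :: real
    and p :: nat
    and u1 u2 :: "nat \<Rightarrow> real^3 \<Rightarrow> real"
  assumes psi_meas: "\<psi> \<in> borel_measurable borel"
    and psi_per: "Z2_periodic \<psi>"
    and "0 < r" and "r < R" and "1 < c"
    and "0 < \<gamma>LV" and "0 \<le> \<gamma>SL" and "0 \<le> \<gamma>SV"
    and "0 \<le> \<theta>Y" and "\<theta>Y \<le> pi"
    and young: "cos \<theta>Y = (\<gamma>SV - \<gamma>SL) / \<gamma>LV"
    and "0 < \<tau>1" and tau2: "\<tau>2 = tau2_of \<theta>Y \<tau>1"
    and init: "(u1 0, u2 0) \<in> admissible p \<psi> c r R"
    and init_fin: "energy p \<psi> c r R \<gamma>LV \<gamma>SL \<gamma>SV \<tau>1 \<tau>2 (u1 0) (u2 0) < \<infinity>"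
    and near_step: "\<And>n. is_arg_min
        (\<lambda>(w1, w2). lin_functional p \<psi> c r R \<gamma>LV \<gamma>SL \<gamma>SV \<tau>1 \<tau>2
           (\<lambda>x. w1 x - u1 (2 * n) x) (\<lambda>x. w2 x - u2 (2 * n) x) (u1 (2 * n)) (u2 (2 * n)))
        (\<lambda>w. w \<in> admissible_near p \<psi> c r R (u1 (2 * n)) (u2 (2 * n)))
        (u1 (2 * n + 1), u2 (2 * n + 1))"
    and far_step: "\<And>n. is_arg_min
        (\<lambda>(w1, w2). energy p \<psi> c r R \<gamma>LV \<gamma>SL \<gamma>SV \<tau>1 \<tau>2 w1 w2)
        (\<lambda>w. w \<in> admissible_far p \<psi> c r R (u1 (2 * n + 1)) (u2 (2 * n + 1)))
        (u1 (2 * n + 2), u2 (2 * n + 2))"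
  shows "\<forall>n. energy p \<psi> c r R \<gamma>LV \<gamma>SL \<gamma>SV \<tau>1 \<tau>2 (u1 (n + 1)) (u2 (n + 1))
             \<le> energy p \<psi> c r R \<gamma>LV \<gamma>SL \<gamma>SV \<tau>1 \<tau>2 (u1 n) (u2 n)"
proof
  have \<tau>2: "0 < \<tau>2"
    unfolding tau2 by (rule tau2_of_pos) fact+
  \<comment> \<open>A minimizer belongs to its feasible set, so every iterate is admissible: odd
    ones come from near steps, even ones from the initial pair or from far steps.\<close>
  have adm_odd: "(u1 (2 * n + 1), u2 (2 * n + 1)) \<in> admissible p \<psi> c r R" for n
    using near_step[of n] by (auto simp: is_arg_min_def admissible_near_def)
  have adm_even: "(u1 (2 * n), u2 (2 * n)) \<in> admissible p \<psi> c r R" for n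
  proof (cases n)
    case (Suc m)
    then show ?thesis using far_step[of m] by (auto simp: is_arg_min_def admissible_far_def)
  qed (simp add: init)
  fix n
  show "energy p \<psi> c r R \<gamma>LV \<gamma>SL \<gamma>SV \<tau>1 \<tau>2 (u1 (n + 1)) (u2 (n + 1))
      \<le> energy p \<psi> c r R \<gamma>LV \<gamma>SL \<gamma>SV \<tau>1 \<tau>2 (u1 n) (u2 n)"
  proof (cases "even n")
    case True
    then obtain m where n: "n = 2 * m" by blast
    \<comment> \<open>The current iterate competes in its own near problem, with zero increment and
      hence value 0.\<close>
    have "(u1 (2 * m), u2 (2 * m)) \<in> admissible_near p \<psi> c r R (u1 (2 * m)) (u2 (2 * m))"
      using adm_even[of m] by (simp add: admissible_near_def)
    from near_step[of m, unfolded is_arg_min_linorder, THEN conjunct2, rule_format, OF this]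
    have "lin_functional p \<psi> c r R \<gamma>LV \<gamma>SL \<gamma>SV \<tau>1 \<tau>2
        (\<lambda>x. u1 (2 * m + 1) x - u1 (2 * m) x) (\<lambda>x. u2 (2 * m + 1) x - u2 (2 * m) x)
        (u1 (2 * m)) (u2 (2 * m)) \<le>
      lin_functional p \<psi> c r R \<gamma>LV \<gamma>SL \<gamma>SV \<tau>1 \<tau>2
        (\<lambda>x. u1 (2 * m) x - u1 (2 * m) x) (\<lambda>x. u2 (2 * m) x - u2 (2 * m) x)
        (u1 (2 * m)) (u2 (2 * m))"
      by (simp only: prod.case)
    also have "\<dots> = 0"
      by (simp add: lin_functional_def)
    finally show ?thesis
      unfolding n using psi_meas \<open>0 < \<tau>1\<close> \<tau>2 \<open>0 < \<gamma>LV\<close> \<open>0 \<le> \<gamma>SL\<close> \<open>0 \<le> \<gamma>SV\<close> adm_even adm_odd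
      by (intro energy_le_of_lin_functional_nonpos) auto
  next
    case False
    then obtain m where n: "n = 2 * m + 1" by (blast elim: oddE)
    \<comment> \<open>The current iterate also competes in the far problem, whose objective is the
      energy itself, so minimality is already the claim.\<close>
    have "(u1 (2 * m + 1), u2 (2 * m + 1)) \<in> admissible_far p \<psi> c r R (u1 (2 * m + 1)) (u2 (2 * m + 1))"
      using adm_odd[of m] by (simp add: admissible_far_def)
    from far_step[of m, unfolded is_arg_min_linorder, THEN conjunct2, rule_format, OF this]
    show ?thesis
      unfolding n by (simp only: prod.case add.assoc one_add_one)
  qed
qed

end
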